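(* For any $k \in \mathbb{N}$ and integers $n_1, n_2, \ldots, n_k \ge 2$, the ordered and reflective Ramsey numbers of the start-central stars $S^{\mathrm{sc}}_{n_1}, \ldots, S^{\mathrm{sc}}_{n_k}$ satisfy $$R_{\mathrm{ord}}(S^{\mathrm{sc}}_{n_1}, S^{\mathrm{sc}}_{n_2}, \ldots, S^{\mathrm{sc}}_{n_k}) = R_{\mathrm{ref}}(S^{\mathrm{sc}}_{n_1}, S^{\mathrm{sc}}_{n_2}, \ldots, S^{\mathrm{sc}}_{n_k}) = \sum_{j=1}^k (n_j - 2) + 2.$$
   Context: $\mathbb{N}=\{1,2,3,\ldots\}$. All graphs are undirected, simple and finite, with vertex set $\{0,1,\ldots,n-1\}$ for some $n\in\mathbb{N}$; $|G|$ denotes the order of $G$. $K_n$ is the complete graph on $n$ vertices. A $k$-edge-coloring of a graph is a map from its edge set to $\{1,\ldots,k\}$. For graphs $G,H$ and a permutation group $\Gamma$ on $V(H)$, $H$ is $\Gamma$-embeddable in $G$ if there is a graph homomorphism from $H$ to $G$ of the form $\psi\circ\varphi$, where $\varphi\in\Gamma$ and $\psi\colon V(H)\to V(G)$ is an increasing injection. For graphs $H_1,\ldots,H_k$ and permutation groups $\Gamma_1,\ldots,\Gamma_k$ on their respective vertex sets, the permutational Ramsey number $R(H_1^{\Gamma_1},\ldots,H_k^{\Gamma_k})$ is the minimum $n\in\mathbb{N}$ such that for every $k$-edge-coloring of $K_n$ there is some $j$ for which $H_j$ is $\Gamma_j$-embeddable in the spanning subgraph of $K_n$ comprising the edges of color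 $j$. The ordered Ramsey number $R_{\mathrm{ord}}(H_1,\ldots,H_k)$ is the one in which each $\Gamma_j$ is the trivial permutation group on $V(H_j)$; the reflective Ramsey number $R_{\mathrm{ref}}(H_1,\ldots,H_k)$ is the one in which each $\Gamma_j$ is the group generated by the reflection $x\mapsto |H_j|-1-x$ of $V(H_j)$. For $n\in\mathbb{N}$, the start-central star $S^{\mathrm{sc}}_n$ is the star graph of order $n$ in which vertex $0$ is adjacent to all the other vertices (and there are no other edges). *)

theory Defs
  imports "HOL-Library.Ramsey" "HOL-Library.FuncSet" "HOL-Algebra.Generated_Groups" "HOL-Algebra.Bij"
begin

text \<open>
  A graph is its order \<open>n\<close> together with its edges, which are two-element subsets of the
  vertex set \<open>{0, \<dots>, n - 1}\<close>.  The natural order of the vertices matters below.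
\<close>

datatype ograph = Graph (order: nat) (edges: "nat set set")

abbreviation verts :: "ograph \<Rightarrow> nat set" where
  "verts G \<equiv> {..<order G}"

definition wf_graph :: "ograph \<Rightarrow> bool" where
  "wf_graph G \<longleftrightarrow> order G \<ge> 1 \<and> edges G \<subseteq> nsets (verts G) 2"

definition graph_hom :: "ograph \<Rightarrow> ograph \<Rightarrow> (nat \<Rightarrow> nat) \<Rightarrow> bool" where
  "graph_hom H G f \<longleftrightarrow> f \<in> verts H \<rightarrow> verts G \<and> (\<forall>e\<in>edges H. f ` e \<in> edges G)"

definition complete_graph :: "nat \<Rightarrow> ograph" where
  "complete_graph n = Graph n (nsets {..<n} 2)"

definition edge_coloring :: "nat \<Rightarrow> ograph \<Rightarrow> (nat set \<Rightarrow> nat) \<Rightarrow> bool" where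
  "edge_coloring k G c \<longleftrightarrow> c \<in> edges G \<rightarrow> {1..k}"

definition color_subgraph :: "ograph \<Rightarrow> (nat set \<Rightarrow> nat) \<Rightarrow> nat \<Rightarrow> ograph" where
  "color_subgraph G c j = Graph (order G) {e \<in> edges G. c e = j}"

text \<open>
  A permutation group on \<open>V(H)\<close> is a subgroup of \<^term>\<open>BijGroup (verts H)\<close>, given by its
  set of elements.  Only the values of the permutations on \<open>V(H)\<close> are relevant.
\<close>

definition embeddable :: "(nat \<Rightarrow> nat) set \<Rightarrow> ograph \<Rightarrow> ograph \<Rightarrow> bool" where
  "embeddable \<Gamma> H G \<longleftrightarrow>
     (\<exists>\<phi>\<in>\<Gamma>. \<exists>\<psi>. \<psi> \<in> verts H \<rightarrow> verts G \<and> strict_mono_on (verts H) \<psi> \<and> graph_hom H G (\<psi> \<circ> \<phi>))"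

text \<open>
  The graphs and groups are families indexed by \<open>1, \<dots>, k\<close>; their values at other
  indices play no role.
\<close>

definition perm_ramsey_number :: "nat \<Rightarrow> (nat \<Rightarrow> ograph) \<Rightarrow> (nat \<Rightarrow> (nat \<Rightarrow> nat) set) \<Rightarrow> nat" where
  "perm_ramsey_number k H \<Gamma> =
     (LEAST n. n \<ge> 1 \<and>
        (\<forall>c. edge_coloring k (complete_graph n) c \<longrightarrow>
           (\<exists>j\<in>{1..k}. embeddable (\<Gamma> j) (H j) (color_subgraph (complete_graph n) c j))))"

definition trivial_perm_group :: "ograph \<Rightarrow> (nat \<Rightarrow> nat) set" where
  "trivial_perm_group H = {\<one>\<^bsub>BijGroup (verts H)\<^esub>}"

definition reflection :: "ograph \<Rightarrow> nat \<Rightarrow> nat" where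
  "reflection H = (\<lambda>x\<in>verts H. order H - 1 - x)"

definition reflection_group :: "ograph \<Rightarrow> (nat \<Rightarrow> nat) set" where
  "reflection_group H = generate (BijGroup (verts H)) {reflection H}"

definition R_ord :: "nat \<Rightarrow> (nat \<Rightarrow> ograph) \<Rightarrow> nat" where
  "R_ord k H = perm_ramsey_number k H (\<lambda>j. trivial_perm_group (H j))"

definition R_ref :: "nat \<Rightarrow> (nat \<Rightarrow> ograph) \<Rightarrow> nat" where
  "R_ref k H = perm_ramsey_number k H (\<lambda>j. reflection_group (H j))"

definition start_central_star :: "nat \<Rightarrow> ograph" where
  "start_central_star n = Graph n {{0, v} | v. 0 < v \<and> v < n}"

lemma wf_complete_graph: "n \<ge> 1 \<Longrightarrow> wf_graph (complete_graph n)"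
  by (simp add: wf_graph_def complete_graph_def)

lemma wf_color_subgraph: "wf_graph G \<Longrightarrow> wf_graph (color_subgraph G c j)"
  by (auto simp: wf_graph_def color_subgraph_def)

lemma wf_start_central_star: "n \<ge> 1 \<Longrightarrow> wf_graph (start_central_star n)"
  by (auto simp: wf_graph_def start_central_star_def nsets_def card_2_iff)

lemma subgroup_trivial_perm_group:
  "subgroup (trivial_perm_group H) (BijGroup (verts H))"
  unfolding trivial_perm_group_def by (rule group.triv_subgroup[OF group_BijGroup])

lemma reflection_in_BijGroup: "reflection H \<in> carrier (BijGroup (verts H))"
proof -
  have "bij_betw (reflection H) (verts H) (verts H)"
    by (rule bij_betw_byWitness[where f' = "reflection H"]) (auto simp: reflection_def)
  then show ?thesis
    by (simp add: BijGroup_def Bij_def reflection_def)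
qed

lemma subgroup_reflection_group:
  "subgroup (reflection_group H) (BijGroup (verts H))"
  unfolding reflection_group_def
  by (rule group.generate_is_subgroup[OF group_BijGroup]) (simp add: reflection_in_BijGroup)

end

theory Submission
  imports Defs
begin

text \<open>
  Let \<open>s = (\<Sum>j = 1..k. n j - 2)\<close>.  An ordered copy of a start-central star consists of a
  vertex and sufficiently many of its right neighbours, and for the reflected star left
  neighbours are admitted as well.  In a coloring of the complete graph on \<open>s + 2\<close> vertices,
  vertex \<open>0\<close> has \<open>s + 1\<close> right neighbours, so by the pigeonhole principle some color \<open>j\<close> occurs
  on at least \<open>n j - 1\<close> of the edges to them, which gives an ordered copy.  On at most \<open>s + 1\<close>
  vertices, on the other hand, the length \<open>v - u\<close> of an edge \<open>{u < v}\<close> takes at most \<open>s\<close>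
  values.  Split these lengths into blocks of sizes \<open>n j - 2\<close> and color each edge by the block of
  its length: a vertex has at most one right neighbour and at most one left neighbour at any given
  distance, so in color \<open>j\<close> it has at most \<open>n j - 2\<close> neighbours on either side.

  Thus the easy bounds for the two Ramsey numbers already coincide, and the value \<open>s + 2\<close> holds for
  every choice of permutations between the trivial and the reflective groups.
\<close>

lemma reflection_in_reflection_group: "reflection H \<in> reflection_group H"
  unfolding reflection_group_def by (rule generate.incl) simp

lemma one_BijGroup_eq: "\<one>\<^bsub>BijGroup S\<^esub> = (\<lambda>x\<in>S. x)"
  by (simp add: BijGroup_def)

lemma reflection_mult_reflection:
  "reflection H \<otimes>\<^bsub>BijGroup (verts H)\<^esub> reflection H = \<one>\<^bsub>BijGroup (verts H)\<^esub>"
proof -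
  have "reflection H \<in> Bij (verts H)"
    using reflection_in_BijGroup[of H] by (simp add: BijGroup_def)
  then have "reflection H \<otimes>\<^bsub>BijGroup (verts H)\<^esub> reflection H
      = compose (verts H) (reflection H) (reflection H)"
    by (simp add: BijGroup_def)
  also have "\<dots> = (\<lambda>x\<in>verts H. x)"
    by (auto simp: compose_def reflection_def restrict_def)
  finally show ?thesis by (simp add: one_BijGroup_eq)
qed

text \<open>The reflection is an involution, so it generates nothing but itself and the identity.\<close>

lemma reflection_group_eq:
  "reflection_group H = {\<one>\<^bsub>BijGroup (verts H)\<^esub>, reflection H}"
proof
  interpret group "BijGroup (verts H)" by (rule group_BijGroup)
  have r: "reflection H \<in> carrier (BijGroup (verts H))" by (rule reflection_in_BijGroup)
  have inv_r: "inv\<^bsub>BijGroup (verts H)\<^esub> reflection H = reflection H"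
    using inv_equality[OF reflection_mult_reflection r r] .
  show "reflection_group H \<subseteq> {\<one>\<^bsub>BijGroup (verts H)\<^esub>, reflection H}"
  proof
    fix h assume "h \<in> reflection_group H"
    then show "h \<in> {\<one>\<^bsub>BijGroup (verts H)\<^esub>, reflection H}"
      unfolding reflection_group_def
      by (induction rule: generate.induct)
        (use r in \<open>auto simp: inv_r reflection_mult_reflection\<close>)
  qed
  show "{\<one>\<^bsub>BijGroup (verts H)\<^esub>, reflection H} \<subseteq> reflection_group H"
    using reflection_in_reflection_group by (auto simp: reflection_group_def intro: generate.one)
qed

text \<open>
  The increasing enumeration of a vertex together with a set of right neighbours starts at that
  vertex, hence maps the center of the star to it.
\<close>

lemma embeddable_start_central_starI:
  assumes "w < order G" and W: "W \<subseteq> {w<..<order G}" "card W = n - 1" and "n \<ge> 1"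
    and adj: "\<And>x. x \<in> W \<Longrightarrow> {w, x} \<in> edges G"
    and \<Gamma>: "trivial_perm_group (start_central_star n) \<subseteq> \<Gamma>"
  shows "embeddable \<Gamma> (start_central_star n) G"
proof -
  let ?M = "insert w W"
  have "finite W" using W(1) finite_subset by blast
  then have M: "finite ?M" "card ?M = n"
    using W \<open>n \<ge> 1\<close> by (auto simp: card_insert_if)
  obtain \<psi> where \<psi>: "bij_betw \<psi> {..<n} ?M" "strict_mono_on {..<n} \<psi>"
    using ex_bij_betw_strict_mono_card[OF M(1)] M(2) by (metis atLeast0LessThan)
  have in_M: "\<psi> i \<in> ?M" if "i < n" for i
    using \<psi>(1) that by (auto simp: bij_betw_def)
  have lower: "w \<le> \<psi> 0"
    using in_M[of 0] W(1) \<open>n \<ge> 1\<close> by auto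
  have \<psi>0: "\<psi> 0 = w"
  proof -
    obtain i where i: "i < n" "\<psi> i = w"
      using bij_betw_imp_surj_on[OF \<psi>(1)] by (metis imageE insertI1 lessThan_iff)
    have "i = 0"
      using strict_mono_onD[OF \<psi>(2), of 0 i] i lower by (cases "i = 0") auto
    then show ?thesis using i by simp
  qed
  have leaf: "\<psi> v \<in> W" if "0 < v" "v < n" for v
    using strict_mono_onD[OF \<psi>(2), of 0 v] in_M[of v] \<psi>0 that by auto
  have range: "\<psi> \<in> {..<n} \<rightarrow> {..<order G}"
    using in_M W(1) \<open>w < order G\<close> by fastforce
  have "graph_hom (start_central_star n) G (\<psi> \<circ> (\<lambda>x\<in>{..<n}. x))"
    using range adj leaf by (auto simp: graph_hom_def start_central_star_def \<psi>0)
  moreover have "(\<lambda>x\<in>{..<n}. x) \<in> \<Gamma>"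
    using \<Gamma> by (simp add: trivial_perm_group_def one_BijGroup_eq start_central_star_def)
  ultimately show ?thesis
    using range \<psi>(2) unfolding embeddable_def by (auto simp: start_central_star_def)
qed

text \<open>
  Both elements of the reflective group send the center to an end of the vertex order, so the
  leaves of an embedded star all lie on one side of its center.
\<close>

lemma embeddable_start_central_starE:
  assumes emb: "embeddable \<Gamma> (start_central_star n) G" and "n \<ge> 1"
    and \<Gamma>: "\<Gamma> \<subseteq> reflection_group (start_central_star n)"
  obtains w W where "W \<subseteq> {..<order G}" "card W = n - 1"
    "(\<forall>x\<in>W. w < x) \<or> (\<forall>x\<in>W. x < w)" "\<And>x. x \<in> W \<Longrightarrow> {w, x} \<in> edges G"
proof -
  let ?S = "start_central_star n"
  have [simp]: "order ?S = n" by (simp add: start_central_star_def)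
  obtain \<phi> \<psi> where "\<phi> \<in> \<Gamma>" and \<psi>: "strict_mono_on {..<n} \<psi>" "\<psi> \<in> {..<n} \<rightarrow> {..<order G}"
    and hom: "graph_hom ?S G (\<psi> \<circ> \<phi>)"
    using emb by (auto simp: embeddable_def)
  have \<phi>: "\<phi> = (\<lambda>x\<in>{..<n}. x) \<or> \<phi> = (\<lambda>x\<in>{..<n}. n - 1 - x)"
    using \<open>\<phi> \<in> \<Gamma>\<close> \<Gamma> by (auto simp: reflection_group_eq one_BijGroup_eq reflection_def)
  define W where "W = (\<psi> \<circ> \<phi>) ` {0<..<n}"
  have lt: "\<psi> a < \<psi> b" if "a < b" "b < n" for a b
    using strict_mono_onD[OF \<psi>(1), of a b] that by auto
  show thesis
  proof
    show "W \<subseteq> {..<order G}"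
      using hom by (auto simp: W_def graph_hom_def)
    have "inj_on \<phi> {0<..<n}"
      using \<phi> by (auto simp: inj_on_def)
    moreover have "\<phi> ` {0<..<n} \<subseteq> {..<n}"
      using \<phi> by auto
    ultimately have "inj_on (\<psi> \<circ> \<phi>) {0<..<n}"
      using strict_mono_on_imp_inj_on[OF \<psi>(1)] by (blast intro: comp_inj_on inj_on_subset)
    then show "card W = n - 1"
      unfolding W_def by (subst card_image) auto
    show "(\<forall>x\<in>W. (\<psi> \<circ> \<phi>) 0 < x) \<or> (\<forall>x\<in>W. x < (\<psi> \<circ> \<phi>) 0)"
      using \<phi> \<open>n \<ge> 1\<close> by (auto simp: W_def intro!: lt)
    show "{(\<psi> \<circ> \<phi>) 0, x} \<in> edges G" if "x \<in> W" for x
    proof -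
      obtain v where v: "0 < v" "v < n" "x = (\<psi> \<circ> \<phi>) v"
        using \<open>x \<in> W\<close> unfolding W_def by (metis greaterThanLessThan_iff imageE)
      then have "{0, v} \<in> edges ?S"
        by (auto simp: start_central_star_def)
      then have "(\<psi> \<circ> \<phi>) ` {0, v} \<in> edges G"
        using hom unfolding graph_hom_def by blast
      then show ?thesis using v by simp
    qed
  qed
qed

text \<open>
  In the extremal coloring, \<open>g\<close> assigns colors to edge lengths: the lengths are cut into
  consecutive blocks, the \<open>j\<close>-th of them having \<open>a j\<close> elements.
\<close>

lemma ex_block_partition:
  fixes a :: "nat \<Rightarrow> nat"
  obtains g where "g \<in> {1..\<Sum>j=1..k. a j} \<rightarrow> {1..k}"
    "\<And>j. j \<in> {1..k} \<Longrightarrow> card {d \<in> {1..\<Sum>j=1..k. a j}. g d = j} \<le> a j"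
proof -
  have "\<exists>g. g \<in> {1..\<Sum>j=1..k. a j} \<rightarrow> {1..k} \<and>
      (\<forall>j\<in>{1..k}. card {d \<in> {1..\<Sum>j=1..k. a j}. g d = j} \<le> a j)"
  proof (induction k)
    case 0
    then show ?case by simp
  next
    case (Suc k)
    define s where "s = (\<Sum>j=1..k. a j)"
    obtain g where g: "g \<in> {1..s} \<rightarrow> {1..k}"
      "\<And>j. j \<in> {1..k} \<Longrightarrow> card {d \<in> {1..s}. g d = j} \<le> a j"
      using Suc unfolding s_def by blast
    let ?g = "\<lambda>d. if d \<le> s then g d else Suc k"
    have sum_Suc: "(\<Sum>j=1..Suc k. a j) = s + a (Suc k)"
      by (simp add: s_def)
    have "?g \<in> {1..s + a (Suc k)} \<rightarrow> {1..Suc k}"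
      using g(1) by fastforce
    moreover have "card {d \<in> {1..s + a (Suc k)}. ?g d = j} \<le> a j" if j: "j \<in> {1..Suc k}" for j
    proof (cases "j = Suc k")
      case True
      have "g d \<noteq> j" if "d \<in> {1..s}" for d
        using funcset_mem[OF g(1) that] True by simp
      then have "{d \<in> {1..s + a (Suc k)}. ?g d = j} \<subseteq> {s<..s + a (Suc k)}"
        by (force split: if_splits simp: not_le[symmetric])
      from card_mono[OF _ this] True show ?thesis by simp
    next
      case False
      then have "{d \<in> {1..s + a (Suc k)}. ?g d = j} = {d \<in> {1..s}. g d = j}"
        by auto
      with g(2)[of j] j False show ?thesis by simp
    qed
    ultimately show ?case unfolding sum_Suc by blast
  qed
  then show thesis using that by blast
qed

lemma doubleton_in_complete_graph:
  "{u, v} \<in> edges (complete_graph N) \<longleftrightarrow> u \<noteq> v \<and> u < N \<and> v < N"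
  by (auto simp: complete_graph_def nsets_def card_insert_if)

text \<open>
  Pigeonhole at vertex \<open>0\<close>: if every color \<open>j\<close> occurred on at most \<open>n j - 2\<close> of its edges,
  there would be too few edges.
\<close>

lemma ramsey_start_central_star_upper:
  assumes n: "\<And>j. j \<in> {1..k} \<Longrightarrow> n j \<ge> 2"
    and \<Gamma>: "\<And>j. j \<in> {1..k} \<Longrightarrow> trivial_perm_group (start_central_star (n j)) \<subseteq> \<Gamma> j"
    and N: "N = (\<Sum>j=1..k. n j - 2) + 2"
    and c: "edge_coloring k (complete_graph N) c"
  shows "\<exists>j\<in>{1..k}. embeddable (\<Gamma> j) (start_central_star (n j))
           (color_subgraph (complete_graph N) c j)"
proof -
  define A where "A j = {v \<in> {0<..<N}. c {0, v} = j}" for j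
  have "{0<..<N} = (\<Union>j\<in>{1..k}. A j)"
    using c N by (fastforce simp: A_def edge_coloring_def doubleton_in_complete_graph)
  then have "N - 1 \<le> (\<Sum>j=1..k. card (A j))"
    using card_UN_le[of "{1..k}" A] by (metis card_greaterThanLessThan finite_atLeastAtMost
        minus_nat.diff_0 diff_Suc_1' diff_commute Suc_eq_plus1 One_nat_def)
  then have "(\<Sum>j=1..k. n j - 2) < (\<Sum>j=1..k. card (A j))"
    using N by simp
  then obtain j where j: "j \<in> {1..k}" "n j - 2 < card (A j)"
    by (meson not_less sum_mono)
  then obtain W where W: "W \<subseteq> A j" "card W = n j - 1"
    using obtain_subset_with_card_n[of "n j - 1" "A j"] by (metis Suc_leI Suc_diff_le diff_Suc_Suc
        n numeral_2_eq_2 One_nat_def)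
  have "embeddable (\<Gamma> j) (start_central_star (n j)) (color_subgraph (complete_graph N) c j)"
  proof (rule embeddable_start_central_starI)
    show "0 < order (color_subgraph (complete_graph N) c j)"
      "W \<subseteq> {0<..<order (color_subgraph (complete_graph N) c j)}"
      using W(1) N by (auto simp: A_def color_subgraph_def complete_graph_def)
    show "{0, x} \<in> edges (color_subgraph (complete_graph N) c j)" if "x \<in> W" for x
      using W(1) that by (auto simp: A_def color_subgraph_def doubleton_in_complete_graph)
  qed (use W n[OF j(1)] \<Gamma>[OF j(1)] in auto)
  with j(1) show ?thesis by blast
qed

text \<open>
  The extremal coloring depends only on the length of an edge.  Along edges to one side of a fixed
  vertex the length determines the other end, so a one-sided star in color \<open>j\<close> has at most
  as many leaves as there are lengths of color \<open>j\<close>.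
\<close>

lemma ramsey_start_central_star_lower:
  assumes n: "\<And>j. j \<in> {1..k} \<Longrightarrow> n j \<ge> 2"
    and \<Gamma>: "\<And>j. j \<in> {1..k} \<Longrightarrow> \<Gamma> j \<subseteq> reflection_group (start_central_star (n j))"
    and N: "N < (\<Sum>j=1..k. n j - 2) + 2"
  obtains c where "edge_coloring k (complete_graph N) c"
    "\<And>j. j \<in> {1..k} \<Longrightarrow> \<not> embeddable (\<Gamma> j) (start_central_star (n j))
       (color_subgraph (complete_graph N) c j)"
proof -
  define s where "s = (\<Sum>j=1..k. n j - 2)"
  obtain g where g: "g \<in> {1..s} \<rightarrow> {1..k}"
    "\<And>j. j \<in> {1..k} \<Longrightarrow> card {d \<in> {1..s}. g d = j} \<le> n j - 2"
    using ex_block_partition[where a = "\<lambda>j. n j - 2"] unfolding s_def by blast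
  define c :: "nat set \<Rightarrow> nat" where "c e = g (Max e - Min e)" for e
  show thesis
  proof
    show "edge_coloring k (complete_graph N) c"
      unfolding edge_coloring_def
    proof
      fix e assume "e \<in> edges (complete_graph N)"
      then obtain u v where e: "e = {u, v}" "u \<noteq> v" "u < N" "v < N"
        by (auto simp: complete_graph_def nsets_def card_2_iff)
      then have "Max e - Min e \<in> {1..s}"
        using N by (auto simp: s_def min_def max_def)
      then show "c e \<in> {1..k}" using g(1) by (auto simp: c_def)
    qed
    show "\<not> embeddable (\<Gamma> j) (start_central_star (n j)) (color_subgraph (complete_graph N) c j)"
      if j: "j \<in> {1..k}" for j
    proof
      assume "embeddable (\<Gamma> j) (start_central_star (n j)) (color_subgraph (complete_graph N) c j)"
      then obtain w W where W: "card W = n j - 1"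
        "(\<forall>x\<in>W. w < x) \<or> (\<forall>x\<in>W. x < w)"
        "\<And>x. x \<in> W \<Longrightarrow> {w, x} \<in> edges (color_subgraph (complete_graph N) c j)"
        by (rule embeddable_start_central_starE) (use n[OF j] \<Gamma>[OF j] in auto)
      define len where "len x = max w x - min w x" for x
      have "inj_on len W"
        using W(2) by (auto simp: len_def inj_on_def max_def min_def split: if_splits)
      moreover have "len ` W \<subseteq> {d \<in> {1..s}. g d = j}"
      proof
        fix d assume "d \<in> len ` W"
        then obtain x where x: "x \<in> W" "d = len x" by blast
        have "w \<noteq> x" "w < N" "x < N" "c {w, x} = j"
          using W(3)[OF x(1)] by (auto simp: color_subgraph_def doubleton_in_complete_graph)
        then show "d \<in> {d \<in> {1..s}. g d = j}"
          using N x(2) by (auto simp: len_def c_def s_def max_def min_def)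
      qed
      ultimately have "card W \<le> card {d \<in> {1..s}. g d = j}"
        by (intro card_inj_on_le) auto
      with W(1) g(2)[OF j] n[OF j] show False by simp
    qed
  qed
qed

lemma perm_ramsey_number_start_central_star:
  assumes n: "\<And>j. j \<in> {1..k} \<Longrightarrow> n j \<ge> 2"
    and \<Gamma>: "\<And>j. j \<in> {1..k} \<Longrightarrow> trivial_perm_group (start_central_star (n j)) \<subseteq> \<Gamma> j"
      "\<And>j. j \<in> {1..k} \<Longrightarrow> \<Gamma> j \<subseteq> reflection_group (start_central_star (n j))"
  shows "perm_ramsey_number k (\<lambda>j. start_central_star (n j)) \<Gamma> = (\<Sum>j=1..k. n j - 2) + 2"
  unfolding perm_ramsey_number_def
proof (rule Least_equality, goal_cases)
  case 1
  show ?case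
    using ramsey_start_central_star_upper[OF n \<Gamma>(1) refl] by simp
next
  case (2 N)
  show ?case
  proof (rule ccontr)
    assume "\<not> (\<Sum>j=1..k. n j - 2) + 2 \<le> N"
    then obtain c where "edge_coloring k (complete_graph N) c"
      "\<And>j. j \<in> {1..k} \<Longrightarrow> \<not> embeddable (\<Gamma> j) (start_central_star (n j))
         (color_subgraph (complete_graph N) c j)"
      using ramsey_start_central_star_lower[of k n \<Gamma> N, OF n \<Gamma>(2)] by (auto simp: not_le)
    with 2 show False by blast
  qed
qed

theorem proposition4p10:
  fixes k :: nat and n :: "nat \<Rightarrow> nat"
  assumes "k \<ge> 1" and "\<And>j. j \<in> {1..k} \<Longrightarrow> n j \<ge> 2"
  shows "R_ord k (\<lambda>j. start_central_star (n j)) = R_ref k (\<lambda>j. start_central_star (n j))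
    \<and> R_ref k (\<lambda>j. start_central_star (n j)) = (\<Sum>j=1..k. (n j - 2)) + 2"
proof -
  have "trivial_perm_group H \<subseteq> reflection_group H" for H
    by (simp add: trivial_perm_group_def reflection_group_eq)
  then show ?thesis
    unfolding R_ord_def R_ref_def
    using perm_ramsey_number_start_central_star[OF assms(2)] by simp
qed

end
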